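(* Let $\mu \in \mathbb{R}$, $\sigma^2 > 0$, let $q(w)$ be the density of $\mathcal{N}(\mu,\sigma^2)$ on $\mathbb{R}$, let $p(w) = C/|w|$ with a constant $C \in (0,\infty)$, and set $u := \mu^2/(2\sigma^2) \ge 0$. Then $\mathrm{KL}(q(w)\,\|\,p(w))$, viewed as a function of $u$ (it depends on $(\mu,\sigma^2)$ only through $u$), is strictly increasing for $u \in [0,\infty)$.
   Context: Here $p$ is a non-normalisable density, and $\mathrm{KL}(q(w)\,\|\,p(w)) := \mathbb{E}_{w\sim q}[\log q(w)] - \mathbb{E}_{w \sim q}[\log p(w)]$ (a "pseudo" KL divergence). *)

theory Defs
  imports "HOL-Probability.Probability"
begin

text \<open>
  The second argument \<open>p\<close> need not be normalisable, so this is not an instance of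
  \<^const>\<open>KL_divergence\<close>. Expectations are Bochner integrals with respect to the
  distribution on the real line with Lebesgue density \<open>q\<close>.
\<close>

definition pseudo_KL :: "(real \<Rightarrow> real) \<Rightarrow> (real \<Rightarrow> real) \<Rightarrow> real" where
  "pseudo_KL q p =
     (\<integral>w. ln (q w) \<partial>density lborel q) - (\<integral>w. ln (p w) \<partial>density lborel q)"

text \<open>
  The Bochner integral of a non-integrable function is 0 by convention, so \<open>pseudo_KL q p\<close>
  is meaningful only under the following condition.
\<close>

definition pseudo_KL_exists :: "(real \<Rightarrow> real) \<Rightarrow> (real \<Rightarrow> real) \<Rightarrow> bool" where
  "pseudo_KL_exists q p \<longleftrightarrow>
     integrable (density lborel q) (\<lambda>w. ln (q w)) \<and>
     integrable (density lborel q) (\<lambda>w. ln (p w))"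

text \<open>At \<open>w = 0\<close> the value is the junk value 0; the point is a Lebesgue null set.\<close>

definition log_uniform :: "real \<Rightarrow> real \<Rightarrow> real" where
  "log_uniform C w = C / \<bar>w\<bar>"

end

(* Write L m for the expectation of ln |w| under N(m, 1). By rescaling, the divergence is a
   constant plus L (\<mu> / \<sigma>), and L is even, so it remains to see that L is strictly increasing on
   [0, \<infinity>). For 0 \<le> a < b the reflection x \<mapsto> a + b - x interchanges the two densities centred at
   a and b, whence
     2 (L b - L a) = \<integral> (\<phi>(x - b) - \<phi>(x - a)) (ln |x| - ln |a + b - x|) dx.
   Both factors have the sign of x - (a + b) / 2, so the integrand is positive almost everywhere. *)
theory Submission
  imports Defs
begin

section \<open>Integrability of \<open>ln \<bar>x\<bar>\<close> against a Gaussian\<close>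

lemma integrable_lborel_powr_at_0:
  fixes a c :: real
  assumes "a > -1" "c \<ge> 0"
  shows "integrable lborel (\<lambda>x. indicator {0..c} x * x powr a)"
proof (rule integrableI_nonneg)
  have "(\<lambda>x. if x \<in> {0..c} then x powr a else 0) = (\<lambda>x. indicator {0..c} x * x powr a)"
    by auto
  then have "((\<lambda>x. indicator {0..c} x * x powr a) has_integral c powr (a + 1) / (a + 1)) UNIV"
    using has_integral_powr_from_0[OF assms]
    by (subst (asm) has_integral_restrict_UNIV[symmetric]) simp
  from nn_integral_has_integral_lborel[OF _ _ this]
  have "(\<integral>\<^sup>+x. ennreal (indicator {0..c} x * x powr a) \<partial>lborel) = ennreal (c powr (a + 1) / (a + 1))"
    by simp
  then show "(\<integral>\<^sup>+x. ennreal (indicator {0..c} x * x powr a) \<partial>lborel) < \<infinity>"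
    by simp
qed auto

text \<open>Near 0, \<open>ln y \<le> y\<close> at y = |x|^(-1/2) trades the logarithm for a power
  with exponent above -1, which is integrable there; the 2 undoes the exponent 1/2. Away from 0 the
  linear term suffices. At x = 0 both sides are 0, as \<open>ln 0 = 0\<close> and
  \<open>0 powr a = 0\<close>.\<close>

lemma abs_ln_abs_le:
  fixes x :: real
  shows "\<bar>ln \<bar>x\<bar>\<bar> \<le> \<bar>x\<bar> + 2 * (indicator {0..1} \<bar>x\<bar> * \<bar>x\<bar> powr (-1/2))"
proof -
  consider "x = 0" | "x \<noteq> 0" "\<bar>x\<bar> \<le> 1" | "\<bar>x\<bar> > 1" by linarith
  then show ?thesis
  proof cases
    case 2
    have "- ln \<bar>x\<bar> / 2 = ln (\<bar>x\<bar> powr (-1/2))" using 2 by (simp add: ln_powr)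
    also have "\<dots> \<le> \<bar>x\<bar> powr (-1/2)" using 2 ln_bound by (simp del: ln_powr)
    finally have "- ln \<bar>x\<bar> \<le> 2 * \<bar>x\<bar> powr (-1/2)" by linarith
    moreover have "ln \<bar>x\<bar> \<le> 0" using 2 by simp
    ultimately have "\<bar>ln \<bar>x\<bar>\<bar> \<le> \<bar>x\<bar> + 2 * \<bar>x\<bar> powr (-1/2)" by linarith
    then show ?thesis using 2 by simp
  next
    case 3
    have "ln \<bar>x\<bar> \<le> \<bar>x\<bar>" using 3 ln_bound[of "\<bar>x\<bar>"] by linarith
    moreover have "ln \<bar>x\<bar> \<ge> 0" using 3 by simp
    ultimately show ?thesis using 3 by simp
  qed simp
qed

lemma integrable_normal_density_ln_abs:
  assumes "\<sigma> > 0"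
  shows "integrable lborel (\<lambda>x. normal_density \<mu> \<sigma> x * ln \<bar>x\<bar>)"
proof -
  \<comment> \<open>\<open>K\<close> is the peak of the density. It replaces the density only in
    front of the singular term; the linear term keeps its Gaussian weight, so that the finite first
    moment applies.\<close>
  define K where "K = 1 / sqrt (2 * pi * \<sigma>\<^sup>2)"
  define g :: "real \<Rightarrow> real" where "g x = indicator {0..1} x * x powr (-1/2)" for x
  have g: "integrable lborel g" unfolding g_def
    by (rule integrable_lborel_powr_at_0) auto
  \<comment> \<open>\<open>g\<close> lives on [0, 1]; its mirror image covers the singularity from
    the left.\<close>
  have int_g: "integrable lborel (\<lambda>x. g x + g (- x))"
    using lborel_integrable_real_affine[OF g, of "-1" 0] g by simp
  have int_id: "integrable lborel (\<lambda>x. \<bar>normal_density \<mu> \<sigma> x * x\<bar>)"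
    by (intro integrable_abs integrable_normal_moment_nz_1 assms)
  have bound: "\<bar>ln \<bar>x\<bar>\<bar> \<le> \<bar>x\<bar> + 2 * (g x + g (- x))" for x
    by (rule order_trans[OF abs_ln_abs_le])
       (auto simp: g_def abs_if split: split_indicator)
  have K: "normal_density \<mu> \<sigma> x \<le> K" for x
    using assms by (auto simp: normal_density_def K_def mult_le_cancel_left1 divide_simps)
  have gnn: "g x \<ge> 0" for x by (simp add: g_def)
  show ?thesis
  proof (rule Bochner_Integration.integrable_bound)
    show "integrable lborel
        (\<lambda>x. \<bar>normal_density \<mu> \<sigma> x * x\<bar> + 2 * K * (g x + g (- x)))"
      by (intro Bochner_Integration.integrable_add int_id integrable_mult_right int_g)
    show "AE x in lborel. norm (normal_density \<mu> \<sigma> x * ln \<bar>x\<bar>)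
        \<le> norm (\<bar>normal_density \<mu> \<sigma> x * x\<bar> + 2 * K * (g x + g (- x)))"
    proof (rule AE_I2)
      fix x
      have "norm (normal_density \<mu> \<sigma> x * ln \<bar>x\<bar>) = normal_density \<mu> \<sigma> x * \<bar>ln \<bar>x\<bar>\<bar>"
        by (simp add: abs_mult)
      also have "\<dots> \<le> normal_density \<mu> \<sigma> x * (\<bar>x\<bar> + 2 * (g x + g (- x)))"
        by (intro mult_left_mono bound) simp
      also have "\<dots> = \<bar>normal_density \<mu> \<sigma> x * x\<bar> + normal_density \<mu> \<sigma> x * (2 * (g x + g (- x)))"
        by (simp add: algebra_simps abs_mult)
      also have "\<dots> \<le> \<bar>normal_density \<mu> \<sigma> x * x\<bar> + K * (2 * (g x + g (- x)))"
        by (intro add_left_mono mult_right_mono K) (simp add: gnn)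
      also have "\<dots> \<le> norm (\<bar>normal_density \<mu> \<sigma> x * x\<bar> + 2 * K * (g x + g (- x)))"
        by (simp add: ac_simps)
      finally show "norm (normal_density \<mu> \<sigma> x * ln \<bar>x\<bar>)
        \<le> norm (\<bar>normal_density \<mu> \<sigma> x * x\<bar> + 2 * K * (g x + g (- x)))" .
    qed
  qed simp
qed

section \<open>Affine substitutions and reduction to unit variance\<close>

lemma normal_density_affine_arg:
  assumes "\<sigma> > 0" "c \<noteq> 0"
  shows "\<bar>c\<bar> * normal_density (t + c * \<mu>) (\<bar>c\<bar> * \<sigma>) (t + c * x) = normal_density \<mu> \<sigma> x"
proof -
  have "(t + c * x - (t + c * \<mu>))\<^sup>2 = c\<^sup>2 * (x - \<mu>)\<^sup>2"
    by (simp add: power2_eq_square algebra_simps)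
  moreover have "sqrt (2 * pi * (\<bar>c\<bar> * \<sigma>)\<^sup>2) = \<bar>c\<bar> * sqrt (2 * pi * \<sigma>\<^sup>2)"
    by (simp add: real_sqrt_mult power_mult_distrib)
  ultimately show ?thesis
    using assms by (simp add: normal_density_def power_mult_distrib)
qed

text \<open>The Jacobian |c| is absorbed by the normalising constant. Negative c is allowed because
  c = -1 yields the reflections, while c = \<sigma> yields the rescaling.\<close>

lemma integral_normal_density_affine:
  fixes f :: "real \<Rightarrow> real"
  assumes "\<sigma> > 0" "c \<noteq> 0"
  shows "(\<integral>x. normal_density (t + c * \<mu>) (\<bar>c\<bar> * \<sigma>) x * f x \<partial>lborel)
       = (\<integral>x. normal_density \<mu> \<sigma> x * f (t + c * x) \<partial>lborel)"
proof -
  have "(\<integral>x. normal_density (t + c * \<mu>) (\<bar>c\<bar> * \<sigma>) x * f x \<partial>lborel)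
      = \<bar>c\<bar> * (\<integral>x. normal_density (t + c * \<mu>) (\<bar>c\<bar> * \<sigma>) (t + c * x) * f (t + c * x) \<partial>lborel)"
    using lborel_integral_real_affine[OF assms(2),
        of "\<lambda>x. normal_density (t + c * \<mu>) (\<bar>c\<bar> * \<sigma>) x * f x" t] by simp
  also have "\<dots> = (\<integral>x. \<bar>c\<bar> * (normal_density (t + c * \<mu>) (\<bar>c\<bar> * \<sigma>) (t + c * x) * f (t + c * x)) \<partial>lborel)"
    by simp
  also have "\<dots> = (\<integral>x. normal_density \<mu> \<sigma> x * f (t + c * x) \<partial>lborel)"
    by (simp only: mult.assoc[symmetric] normal_density_affine_arg[OF assms])
  finally show ?thesis .
qed

definition gauss_log_moment :: "real \<Rightarrow> real" where
  "gauss_log_moment m = (\<integral>x. normal_density m 1 x * ln \<bar>x\<bar> \<partial>lborel)"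

lemma gauss_log_moment_minus: "gauss_log_moment (- m) = gauss_log_moment m"
  using integral_normal_density_affine[of 1 "-1" 0 m "\<lambda>x. ln \<bar>x\<bar>"]
  by (simp add: gauss_log_moment_def)

lemma gauss_log_moment_abs: "gauss_log_moment \<bar>m\<bar> = gauss_log_moment m"
  by (simp add: abs_if gauss_log_moment_minus)

lemma integral_normal_density_ln_abs:
  assumes "\<sigma> > 0"
  shows "(\<integral>x. normal_density \<mu> \<sigma> x * ln \<bar>x\<bar> \<partial>lborel) = ln \<sigma> + gauss_log_moment (\<mu> / \<sigma>)"
proof -
  have "(\<integral>x. normal_density \<mu> \<sigma> x * ln \<bar>x\<bar> \<partial>lborel)
      = (\<integral>x. normal_density (\<mu> / \<sigma>) 1 x * ln \<bar>\<sigma> * x\<bar> \<partial>lborel)"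
    using integral_normal_density_affine[of 1 \<sigma> 0 "\<mu> / \<sigma>" "\<lambda>x. ln \<bar>x\<bar>"] assms by simp
  also have "\<dots> = (\<integral>x. normal_density (\<mu> / \<sigma>) 1 x * ln \<sigma>
      + normal_density (\<mu> / \<sigma>) 1 x * ln \<bar>x\<bar> \<partial>lborel)"
  \<comment> \<open>The logarithm of the product splits only for x \<noteq> 0: at 0 the left side is
    0 by \<open>ln 0 = 0\<close>, while the right side keeps the term with
    \<open>ln \<sigma>\<close>.\<close>
  proof (rule integral_cong_AE)
    show "AE x in lborel. normal_density (\<mu> / \<sigma>) 1 x * ln \<bar>\<sigma> * x\<bar>
      = normal_density (\<mu> / \<sigma>) 1 x * ln \<sigma> + normal_density (\<mu> / \<sigma>) 1 x * ln \<bar>x\<bar>"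
      using AE_lborel_singleton[of 0]
      by eventually_elim (use assms in \<open>simp add: abs_mult ln_mult algebra_simps\<close>)
  qed simp_all
  also have "\<dots> = ln \<sigma> + gauss_log_moment (\<mu> / \<sigma>)"
    unfolding gauss_log_moment_def
    by (subst Bochner_Integration.integral_add) (auto intro: integrable_normal_density_ln_abs)
  finally show ?thesis .
qed

section \<open>Strict monotonicity of the logarithmic moment by reflection\<close>

lemma normal_density_less_iff:
  assumes "\<sigma> > 0"
  shows "normal_density a \<sigma> x < normal_density b \<sigma> x \<longleftrightarrow> \<bar>x - b\<bar> < \<bar>x - a\<bar>"
proof -
  have "normal_density a \<sigma> x < normal_density b \<sigma> x \<longleftrightarrow> (x - b)\<^sup>2 < (x - a)\<^sup>2"
    using assms by (simp add: normal_density_def divide_simps)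
  then show ?thesis by (metis abs_le_square_iff linorder_not_less)
qed

lemma gauss_log_moment_strict_mono: "strict_mono_on {0..} gauss_log_moment"
proof (rule strict_mono_onI)
  fix a b :: real
  assume "a \<in> {0..}" "b \<in> {0..}" "a < b"
  then have ab: "0 \<le> a" "a < b" by auto
  define h where "h x = (normal_density b 1 x - normal_density a 1 x)
      * (ln \<bar>x\<bar> - ln \<bar>a + b - x\<bar>)" for x
  note int = integrable_normal_density_ln_abs[OF zero_less_one]
  have refl: "normal_density m 1 (a + b - x) = normal_density (a + b - m) 1 x" for m x
    by (simp add: normal_density_def power2_commute algebra_simps)
  have int_refl: "integrable lborel (\<lambda>x. normal_density m 1 x * ln \<bar>a + b - x\<bar>)" for m
    using lborel_integrable_real_affine[OF int[of "a + b - m"], of "-1" "a + b"]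
    by (simp add: refl)
  have eq_refl: "(\<integral>x. normal_density m 1 x * ln \<bar>a + b - x\<bar> \<partial>lborel)
      = gauss_log_moment (a + b - m)" for m
    using integral_normal_density_affine[of 1 "-1" "a + b" m "\<lambda>x. ln \<bar>x\<bar>"]
    by (simp add: gauss_log_moment_def)
  have h_eq: "h = (\<lambda>x. (normal_density b 1 x * ln \<bar>x\<bar> - normal_density a 1 x * ln \<bar>x\<bar>)
      - (normal_density b 1 x * ln \<bar>a + b - x\<bar> - normal_density a 1 x * ln \<bar>a + b - x\<bar>))"
    by (auto simp: h_def algebra_simps)
  have h_int: "integrable lborel h"
    unfolding h_eq by (intro Bochner_Integration.integrable_diff int int_refl)
  \<comment> \<open>By \<open>eq_refl\<close>, the reflected logarithm turns the moment at b into
    that at a and conversely, so the second bracket integrates to the negative of the first; hence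
    the factor 2.\<close>
  have "integral\<^sup>L lborel h = 2 * (gauss_log_moment b - gauss_log_moment a)"
    unfolding h_eq
    by (simp add: Bochner_Integration.integral_diff Bochner_Integration.integrable_diff
        int int_refl eq_refl) (simp add: gauss_log_moment_def)
  \<comment> \<open>Both factors vanish at the midpoint, and at 0 and a + b one logarithm has the
    default value \<open>ln 0 = 0\<close>. Elsewhere the logarithms compare as claimed because a + b
    > 0.\<close>
  moreover have pos: "h x > 0" if "x \<noteq> 0" "x \<noteq> a + b" "x \<noteq> (a + b) / 2" for x
  proof (cases "x > (a + b) / 2")
    case True
    then have "\<bar>x - b\<bar> < \<bar>x - a\<bar>" "\<bar>a + b - x\<bar> < \<bar>x\<bar>" "0 < \<bar>a + b - x\<bar>"
      using ab that by (auto simp: field_simps abs_if)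
    then show ?thesis
      unfolding h_def by (intro mult_pos_pos) (auto simp: normal_density_less_iff)
  next
    case False
    then have "\<bar>x - a\<bar> < \<bar>x - b\<bar>" "\<bar>x\<bar> < \<bar>a + b - x\<bar>" "0 < \<bar>x\<bar>"
      using ab that by (auto simp: field_simps abs_if)
    then show ?thesis
      unfolding h_def by (intro mult_neg_neg) (auto simp: normal_density_less_iff)
  qed
  have ae: "AE x in lborel. h x > 0"
    using AE_lborel_singleton[of 0] AE_lborel_singleton[of "a + b"] AE_lborel_singleton[of "(a + b) / 2"]
    by eventually_elim (rule pos)
  have nn: "AE x in lborel. 0 \<le> h x"
    using ae by eventually_elim simp
  have "integral\<^sup>L lborel h \<noteq> 0"
  proof
    assume "integral\<^sup>L lborel h = 0"
    then have "AE x in lborel. h x = 0"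
      using integral_nonneg_eq_0_iff_AE[OF h_int nn] by simp
    \<comment> \<open>\<open>h\<close> would be both zero and positive almost everywhere, so the
      whole line would be a null set.\<close>
    with ae have "AE x in (lborel :: real measure). False"
      by eventually_elim simp
    then show False
      by (simp add: trivial_limit_def[symmetric] ae_filter_eq_bot_iff)
  qed
  then have "integral\<^sup>L lborel h > 0"
    using integral_nonneg_AE[OF nn] by simp
  ultimately show "gauss_log_moment a < gauss_log_moment b" by simp
qed

section \<open>The two expectations and the divergence\<close>

lemma ln_normal_density:
  assumes "\<sigma> > 0"
  shows "ln (normal_density \<mu> \<sigma> x) = - ln (sqrt (2 * pi)) - ln \<sigma> - (x - \<mu>)\<^sup>2 / (2 * \<sigma>\<^sup>2)"
  using assms by (simp add: normal_density_def ln_mult ln_div real_sqrt_mult)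

text \<open>This is the negative differential entropy: the quadratic term averages to the variance
  over 2 \<sigma>^2, which is 1/2. The mean drops out, and \<open>- ln \<sigma>\<close> later
  cancels against the prior term.\<close>

lemma has_bochner_integral_ln_normal_density:
  assumes "\<sigma> > 0"
  shows "has_bochner_integral lborel (\<lambda>x. normal_density \<mu> \<sigma> x * ln (normal_density \<mu> \<sigma> x))
           (- ln (sqrt (2 * pi)) - ln \<sigma> - 1 / 2)"
proof -
  have 0: "has_bochner_integral lborel (normal_density \<mu> \<sigma>) 1"
    using normal_moment_even[OF assms, of \<mu> 0] by simp
  have 1: "has_bochner_integral lborel (\<lambda>x. normal_density \<mu> \<sigma> x * (x - \<mu>)\<^sup>2) (\<sigma>\<^sup>2)"
    using normal_moment_even[OF assms, of \<mu> 1] by (simp add: fact_numeral)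
  have "has_bochner_integral lborel
      (\<lambda>x. normal_density \<mu> \<sigma> x * (- ln (sqrt (2 * pi)) - ln \<sigma>)
         - normal_density \<mu> \<sigma> x * (x - \<mu>)\<^sup>2 * (1 / (2 * \<sigma>\<^sup>2)))
      (1 * (- ln (sqrt (2 * pi)) - ln \<sigma>) - \<sigma>\<^sup>2 * (1 / (2 * \<sigma>\<^sup>2)))"
    by (intro has_bochner_integral_diff has_bochner_integral_mult_left 0 1)
  then show ?thesis
    using assms by (simp add: ln_normal_density algebra_simps)
qed

lemma has_bochner_integral_ln_log_uniform:
  assumes "\<sigma> > 0" "C > 0"
  shows "has_bochner_integral lborel (\<lambda>x. normal_density \<mu> \<sigma> x * ln (log_uniform C x))
           (ln C - (ln \<sigma> + gauss_log_moment (\<mu> / \<sigma>)))"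
proof -
  have 0: "has_bochner_integral lborel (normal_density \<mu> \<sigma>) 1"
    using normal_moment_even[OF assms(1), of \<mu> 0] by simp
  have 1: "has_bochner_integral lborel (\<lambda>x. normal_density \<mu> \<sigma> x * ln \<bar>x\<bar>)
      (ln \<sigma> + gauss_log_moment (\<mu> / \<sigma>))"
    using has_bochner_integral_integrable[OF integrable_normal_density_ln_abs[OF assms(1)]]
    by (simp add: integral_normal_density_ln_abs assms)
  have "has_bochner_integral lborel
      (\<lambda>x. normal_density \<mu> \<sigma> x * ln C - normal_density \<mu> \<sigma> x * ln \<bar>x\<bar>)
      (1 * ln C - (ln \<sigma> + gauss_log_moment (\<mu> / \<sigma>)))"
    by (intro has_bochner_integral_diff has_bochner_integral_mult_left 0 1)
  \<comment> \<open>The point 0 is excluded because there \<open>C / 0 = 0\<close> makes the right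
    side 0, while the left side still contains \<open>ln C\<close>.\<close>
  moreover have "AE x in lborel. normal_density \<mu> \<sigma> x * ln C - normal_density \<mu> \<sigma> x * ln \<bar>x\<bar>
      = normal_density \<mu> \<sigma> x * ln (log_uniform C x)"
    using AE_lborel_singleton[of 0]
    by eventually_elim (use assms in \<open>simp add: log_uniform_def ln_div algebra_simps\<close>)
  ultimately show ?thesis
    by (subst (asm) has_bochner_integral_cong_AE) (auto simp: log_uniform_def[abs_def])
qed

theorem mainTheorem3:
  fixes C :: real
  assumes "C > 0"
  shows "(\<forall>\<mu> \<sigma>. \<sigma> > 0 \<longrightarrow> pseudo_KL_exists (normal_density \<mu> \<sigma>) (log_uniform C)) \<and>
    (\<exists>F :: real \<Rightarrow> real.
       (\<forall>\<mu> \<sigma>. \<sigma> > 0 \<longrightarrow>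
          pseudo_KL (normal_density \<mu> \<sigma>) (log_uniform C) = F (\<mu>\<^sup>2 / (2 * \<sigma>\<^sup>2))) \<and>
       strict_mono_on {0..} F)"
proof (intro conjI allI impI exI)
  have [measurable]: "log_uniform C \<in> borel_measurable borel"
    by (simp add: log_uniform_def[abs_def])
  fix \<mu> \<sigma> :: real
  assume \<sigma>: "\<sigma> > 0"
  note q = has_bochner_integral_ln_normal_density[OF \<sigma>, of \<mu>]
  note p = has_bochner_integral_ln_log_uniform[OF \<sigma> assms, of \<mu>]
  show "pseudo_KL_exists (normal_density \<mu> \<sigma>) (log_uniform C)"
    using q p by (auto simp: pseudo_KL_exists_def integrable_density has_bochner_integral_iff)
  \<comment> \<open>With u = \<mu>^2 / (2 \<sigma>^2), sqrt(2 u) recovers |\<mu> / \<sigma>|; the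
    lost sign is harmless since the moment is even. This dictates the witness for
    \<open>F\<close>.\<close>
  have "\<mu>\<^sup>2 / \<sigma>\<^sup>2 = (\<mu> / \<sigma>)\<^sup>2" by (simp add: power_divide)
  then have "sqrt (2 * (\<mu>\<^sup>2 / (2 * \<sigma>\<^sup>2))) = \<bar>\<mu> / \<sigma>\<bar>" by simp
  then show "pseudo_KL (normal_density \<mu> \<sigma>) (log_uniform C)
      = (\<lambda>u. gauss_log_moment (sqrt (2 * u)) - (ln C + ln (sqrt (2 * pi)) + 1 / 2))
          (\<mu>\<^sup>2 / (2 * \<sigma>\<^sup>2))"
    using q p by (simp add: pseudo_KL_def integral_density has_bochner_integral_iff
        gauss_log_moment_abs del: abs_divide)
next
  show "strict_mono_on {0..}
      (\<lambda>u. gauss_log_moment (sqrt (2 * u)) - (ln C + ln (sqrt (2 * pi)) + 1 / 2))"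
    \<comment> \<open>The map u \<mapsto> sqrt(2 u) is strictly increasing from [0, \<infinity>)
      into itself, so composing with it preserves strict monotonicity.\<close>
    using gauss_log_moment_strict_mono by (auto simp: strict_mono_on_def)
qed

end
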